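(* Consider problems (P) and (R) and the PLDM iteration described in the context, under the standing assumptions listed in the context. Let $\epsilon>0$. If the penalty parameters $M_i>0$ ($i\in\mathcal N$) are sufficiently large, then every critical point $(\bar{\mathbf X}^*,\mathbf Z^*,\boldsymbol\lambda^*,\boldsymbol\mu^* )$ of problem (R) obtained from PLDM (i.e. as a limit of the iterates $(\bar{\mathbf X}^k,\mathbf Z^k,\boldsymbol\lambda^k,\boldsymbol\mu^k)$) is an $\epsilon$-critical point of problem (P).
   Context: Problems. $\mathcal N=\{1,\dots,N\}$ is a set of agents; $\mathcal N_i\subseteq\mathcal N$ consists of $i$ and its neighbours; $\bar n_i=\sum_{j\in\mathcal N_i}n_j$. For each $i$: $\mathcal X_i\subset\mathbb R^{n_i}$ is bounded and convex, $f_i:\mathbb R^{n_i}\to\mathbb R$, $\phi_i:\mathbb R^{\bar n_i}\to\mathbb R$, $h_i:\mathbb R^{\bar n_i}\to\mathbb R^{m_i}$. Put $\mathcal X=\prod_{i}\mathcal X_i$. Agent $i$ holds $\mathbf X_i\in\mathbb R^{\bar n_i}$ (its own component and copies of its neighbours' components), a slack $\mathbf Y_i\in\mathbb R^{\bar n_i}$, and $\bar{\mathbf X}_i=(\mathbf X_i,\mathbf Y_i)\in\mathbb R^{2\bar n_i}$; $\bar{\mathbf X}=(\bar{\mathbf X}_i)_i$. $\mathbf Z\in\mathbb R^{\sum_i n_i}$ is the consensus variable. $\tilde f_i(\mathbf X_i)$ is $f_i$ evaluated at agent $i$'s own component of $\mathbf X_i$; $\mathbf A_i=[\mathbf I_{\bar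 n_i},\mathbf I_{\bar n_i}]$; $\mathbf E_i$ is the $0/1$ matrix with $\mathbf E_i\mathbf Z=(z_j)_{j\in\mathcal N_i}$. (P) $\min_{\bar{\mathbf X},\mathbf Z}\ \sum_i\big(\tilde f_i(\mathbf X_i)+\phi_i(\mathbf X_i)\big)$ s.t. $h_i(\mathbf X_i)=0$, $\mathbf A_i\bar{\mathbf X}_i=\mathbf E_i\mathbf Z$, $\mathbf Y_i=0$ for all $i$, and $\mathbf Z\in\mathcal X$. (R) $\min_{\bar{\mathbf X},\mathbf Z}\ \sum_i\big(\tilde f_i(\mathbf X_i)+\phi_i(\mathbf X_i)+M_i\|\mathbf Y_i\|^2\big)$ s.t. $h_i(\mathbf X_i)=0$, $\mathbf A_i\bar{\mathbf X}_i=\mathbf E_i\mathbf Z$ for all $i$, and $\mathbf Z\in\mathcal X$, with parameters $M_i>0$. Augmented Lagrangian of (R), with $\boldsymbol\lambda_i\in\mathbb R^{m_i}$, $\boldsymbol\mu_i\in\mathbb R^{\bar n_i}$, $\rho>0$: $\mathbb L_\rho(\bar{\mathbf X},\mathbf Z,\boldsymbol\lambda,\boldsymbol\mu)=\sum_i\big(g_i(\bar{\mathbf X}_i,\boldsymbol\lambda_i,\rho)+\boldsymbol\mu_i^T(\mathbf A_i\bar{\mathbf X}_i-\mathbf E_i\mathbf Z)+\frac\rho2\|\mathbf A_i\bar{\mathbf X}_i-\mathbf E_i\mathbf Z\|^2\big)$, where $g_i(\bar{\mathbf X}_i,\boldsymbol\lambda_i,\rho)=\tilde f_i(\mathbf X_i)+\phi_i(\mathbf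 X_i)+\boldsymbol\lambda_i^Th_i(\mathbf X_i)+\frac\rho2\|h_i(\mathbf X_i)\|^2+M_i\|\mathbf Y_i\|^2$. Sub-feasible region, for a fixed $\eta>0$: $\bar{\mathcal X}^\eta=\{\bar{\mathbf X}:\sum_i\|h_i(\mathbf X_i)\|\le\eta\}$; $\bar{\mathcal X}_i^\eta$ is its projection onto the component $\bar{\mathbf X}_i$ (taken to be bounded). PLDM (Proximal Linearization-based Decentralized Method). Given $\boldsymbol\lambda^0,\boldsymbol\mu^0,\bar{\mathbf X}^0,\mathbf Z^0,\rho_0>0$, an increment $\delta>0$ and step-sizes $c_i^k>0$, for $k=0,1,2,\dots$: 1. $\mathbf Z^{k+1}\in\arg\min_{\mathbf Z\in\mathcal X}\mathbb L_{\rho_k}(\bar{\mathbf X}^k,\mathbf Z,\boldsymbol\lambda^k,\boldsymbol\mu^k)$; 2. for each $i$, $\bar{\mathbf X}_i^{k+1}=\arg\min_{\bar{\mathbf X}_i}\ (\boldsymbol\mu_i^k)^T(\mathbf A_i\bar{\mathbf X}_i-\mathbf E_i\mathbf Z^{k+1})+\frac{\rho_k}2\|\mathbf A_i\bar{\mathbf X}_i-\mathbf E_i\mathbf Z^{k+1}\|^2+\langle\nabla_{\bar{\mathbf X}_i}g_i(\bar{\mathbf X}_i^k,\boldsymbol\lambda_i^k,\rho_k),\bar{\mathbf X}_i-\bar{\mathbf X}_i^k\rangle+\frac{c_i^k}2\|\bar{\mathbf X}_i-\bar{\mathbf X}_i^k\|^2$; 3. $\boldsymbol\lambda_i^{k+1}=\boldsymbol\lambda_i^k+\rho_kh_i(\mathbf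 X_i^{k+1})$, $\boldsymbol\mu_i^{k+1}=\boldsymbol\mu_i^k+\rho_k(\mathbf A_i\bar{\mathbf X}_i^{k+1}-\mathbf E_i\mathbf Z^{k+1})$; 4. $\rho_{k+1}=\rho_k$ if $\bar{\mathbf X}^{k+1}\in\bar{\mathcal X}^\eta$, and $\rho_{k+1}=\rho_k+\delta$ otherwise. (Asymptotic statements concern the sequence generated without stopping.) Standing assumptions. (A1) $h_i$ is continuously differentiable, and $h_i,\nabla h_i$ are Lipschitz with constants $L_{h_i},M_{h_i}$, over $\prod_{j\in\mathcal N_i}\mathcal X_j$. (A2) $f_i,\nabla f_i$ are Lipschitz with constants $L_{f_i},M_{f_i}$ over $\mathcal X_i$. (A3) $\phi_i,\nabla\phi_i$ are Lipschitz with constants $L_{\phi_i},M_{\phi_i}$ over $\prod_{j\in\mathcal N_i}\mathcal X_j$. (A4) The $M_i>0$ are sufficiently large. (A5) With $\mathbf F_i(\bar{\mathbf X}_i)=\begin{pmatrix}\nabla h_i(\mathbf X_i)&\mathbf O\\ \mathbf I_{\bar n_i}&\mathbf I_{\bar n_i}\end{pmatrix}$ ($\nabla h_i$ the $m_i\times\bar n_i$ Jacobian, $\mathbf O$ the $m_i\times\bar n_i$ zero matrix), there is $\theta>0$ with $\|\mathbf F_i(\bar{\mathbf X}_i)^Tv\|\ge\theta\|v\|$ for all $v$ and all $\bar{\mathbf X}_i\in\bar{\mathcal X}_i^\eta$. (A6) The multipliers satisfy $\|\boldsymbol\lambda_i^k\|\le M_{\boldsymbol\lambda_i}$, $\|\boldsymbol\mu_i^k\|\le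 M_{\boldsymbol\mu_i}$ for all $k$. (A7) For proper $\rho<+\infty$, $\inf_{\bar{\mathbf X},\,\mathbf Z\in\mathcal X}\mathbb L_\rho(\bar{\mathbf X},\mathbf Z,\boldsymbol\lambda,\boldsymbol\mu)>-\infty$. Critical points. $\mathcal N_{\mathcal X}(\mathbf Z)=\{g:g^T(x-\mathbf Z)\le0\ \forall x\in\mathcal X\}$ for $\mathbf Z\in\mathcal X$, and $\varnothing$ otherwise. A critical point of (R) is $(\bar{\mathbf X},\mathbf Z,\boldsymbol\lambda,\boldsymbol\mu)$ with $\nabla_{\bar{\mathbf X}}\mathbb L_\rho=0$, $0\in\nabla_{\mathbf Z}\mathbb L_\rho+\mathcal N_{\mathcal X}(\mathbf Z)$, $h_i(\mathbf X_i)=0$ and $\mathbf A_i\bar{\mathbf X}_i=\mathbf E_i\mathbf Z$ for all $i$. In general the critical points of a constrained problem are its KKT points (feasible points satisfying the first-order optimality conditions with some multipliers), and $\epsilon$-critical points are obtained by relaxing each of these conditions from $0$ to tolerance $\epsilon$. For (P) this means: there exist multipliers $\boldsymbol\lambda_i,\boldsymbol\mu_i,\boldsymbol\nu_i$ (for $h_i=0$, $\mathbf A_i\bar{\mathbf X}_i=\mathbf E_i\mathbf Z$, $\mathbf Y_i=0$) such that, for all $i$, each of $\nabla\tilde f_i(\mathbf X_i)+\nabla\phi_i(\mathbf X_i)+(\nabla h_i(\mathbf X_i))^T\boldsymbol\lambda_i+\boldsymbol\mu_i$, $\ \boldsymbol\mu_i+\boldsymbol\nu_i$, $\ h_i(\mathbf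 X_i)$, $\ \mathbf A_i\bar{\mathbf X}_i-\mathbf E_i\mathbf Z$, $\ \mathbf Y_i$ has norm at most $\epsilon$, and $\mathrm{dist}\big(0,-\sum_i\mathbf E_i^T\boldsymbol\mu_i+\mathcal N_{\mathcal X}(\mathbf Z)\big)\le\epsilon$. *)

theory Defs
  imports "HOL-Analysis.Analysis"
begin

(* Spaces of agent-dependent dimension are coordinate subspaces of one ambient space.
   The agents are the elements of a finite type 'a, the coordinates of Z are the elements of a
   finite type 'c, and agent i owns n_i = card {c. owner c = i} of them.  A vector of R^(n_i), or of
   the space of stacked components (z_j), j in N_i, is an element of real^'c vanishing at all other
   coordinates; likewise R^(m_i) is the coordinate subspace of real^'m given by the index set
   rows P i of size m_i.  Functions matter only on these subspaces, so derivatives are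
   taken within them. *)

definition coord_space :: "'k set \<Rightarrow> (real^'k::finite) set" where
  "coord_space I = {v. \<forall>k. k \<notin> I \<longrightarrow> v $ k = 0}"

definition restr :: "'k set \<Rightarrow> real^'k \<Rightarrow> real^'k::finite" where
  "restr I v = (\<chi> k. if k \<in> I then v $ k else 0)"

(* The gradient, at a point x of the linear subspace S, of f regarded as a function on the
   Euclidean space S.  It is unique when it exists. *)

definition has_grad_on :: "'v::euclidean_space set \<Rightarrow> ('v \<Rightarrow> real) \<Rightarrow> 'v \<Rightarrow> 'v \<Rightarrow> bool" where
  "has_grad_on S f x g \<longleftrightarrow> g \<in> S \<and> (f has_derivative (\<lambda>d. g \<bullet> d)) (at x within S)"

definition grad_on :: "'v::euclidean_space set \<Rightarrow> ('v \<Rightarrow> real) \<Rightarrow> 'v \<Rightarrow> 'v" where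
  "grad_on S f x = (THE g. has_grad_on S f x g)"

definition jacobian_on ::
    "(real^'c::finite) set \<Rightarrow> (real^'c \<Rightarrow> real^'m::finite) \<Rightarrow> real^'c \<Rightarrow> real^'c^'m" where
  "jacobian_on S h x = (\<chi> r. grad_on S (\<lambda>y. h y $ r) x)"

definition normal_cone :: "'v::real_inner set \<Rightarrow> 'v \<Rightarrow> 'v set" where
  "normal_cone S z = (if z \<in> S then {g. \<forall>x\<in>S. g \<bullet> (x - z) \<le> 0} else {})"

(* cost, coupling, constr are f_i, phi_i, h_i; local_set is the set X_i;
   nbhd i is N_i, which contains i itself. *)

record ('a, 'c, 'm) problem =
  owner :: "'c \<Rightarrow> 'a"
  nbhd :: "'a \<Rightarrow> 'a set"
  rows :: "'a \<Rightarrow> 'm set"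
  local_set :: "'a \<Rightarrow> (real^'c) set"
  cost :: "'a \<Rightarrow> real^'c \<Rightarrow> real"
  coupling :: "'a \<Rightarrow> real^'c \<Rightarrow> real"
  constr :: "'a \<Rightarrow> real^'c \<Rightarrow> real^'m"

definition own_coords :: "('a, 'c::finite, 'm::finite) problem \<Rightarrow> 'a \<Rightarrow> 'c set" where
  "own_coords P i = {c. owner P c = i}"

definition nbhd_coords :: "('a, 'c::finite, 'm::finite) problem \<Rightarrow> 'a \<Rightarrow> 'c set" where
  "nbhd_coords P i = {c. owner P c \<in> nbhd P i}"

abbreviation own_space :: "('a, 'c::finite, 'm::finite) problem \<Rightarrow> 'a \<Rightarrow> (real^'c) set" where
  "own_space P i \<equiv> coord_space (own_coords P i)"

abbreviation nbhd_space :: "('a, 'c::finite, 'm::finite) problem \<Rightarrow> 'a \<Rightarrow> (real^'c) set" where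
  "nbhd_space P i \<equiv> coord_space (nbhd_coords P i)"

abbreviation constr_space :: "('a, 'c::finite, 'm::finite) problem \<Rightarrow> 'a \<Rightarrow> (real^'m) set" where
  "constr_space P i \<equiv> coord_space (rows P i)"

definition global_set :: "('a, 'c::finite, 'm::finite) problem \<Rightarrow> (real^'c) set" where
  "global_set P = {z. \<forall>i. restr (own_coords P i) z \<in> local_set P i}"

definition nbhd_set :: "('a, 'c::finite, 'm::finite) problem \<Rightarrow> 'a \<Rightarrow> (real^'c) set" where
  "nbhd_set P i =
     {x \<in> nbhd_space P i. \<forall>j\<in>nbhd P i. restr (own_coords P j) x \<in> local_set P j}"

definition well_formed :: "('a::finite, 'c::finite, 'm::finite) problem \<Rightarrow> bool" where
  "well_formed P \<longleftrightarrow> (\<forall>i.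
     i \<in> nbhd P i \<and>
     local_set P i \<subseteq> own_space P i \<and> bounded (local_set P i) \<and> convex (local_set P i) \<and>
     (\<forall>x\<in>nbhd_space P i. constr P i x \<in> constr_space P i))"

(* The pair (X_i, Y_i) and the families of such pairs and of multipliers. *)

type_synonym ('a, 'c) primal = "((real^'c) \<times> (real^'c))^'a"

definition primal_space ::
    "('a::finite, 'c::finite, 'm::finite) problem \<Rightarrow> ('a, 'c) primal set" where
  "primal_space P = {X. \<forall>i. X $ i \<in> nbhd_space P i \<times> nbhd_space P i}"

definition lam_space :: "('a::finite, 'c::finite, 'm::finite) problem \<Rightarrow> (real^'m^'a) set" where
  "lam_space P = {lam. \<forall>i. lam $ i \<in> constr_space P i}"

definition mu_space :: "('a::finite, 'c::finite, 'm::finite) problem \<Rightarrow> (real^'c^'a) set" where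
  "mu_space P = {mu. \<forall>i. mu $ i \<in> nbhd_space P i}"

definition own_cost ::
    "('a::finite, 'c::finite, 'm::finite) problem \<Rightarrow> 'a \<Rightarrow> real^'c \<Rightarrow> real" where
  "own_cost P i x = cost P i (restr (own_coords P i) x)"

definition Aop :: "(real^'c) \<times> (real^'c) \<Rightarrow> real^'c::finite" where
  "Aop x = fst x + snd x"

(* Under the embedding of the stacked components into real^'c, the 0/1 selection matrix becomes
   the diagonal matrix selecting the coordinates owned by N_i. *)

definition Emat :: "('a, 'c::finite, 'm::finite) problem \<Rightarrow> 'a \<Rightarrow> real^'c^'c" where
  "Emat P i = (\<chi> r c. if r = c \<and> c \<in> nbhd_coords P i then 1 else 0)"

definition gfun :: "('a::finite, 'c::finite, 'm::finite) problem \<Rightarrow> ('a \<Rightarrow> real) \<Rightarrow> 'a \<Rightarrow>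
    (real^'c) \<times> (real^'c) \<Rightarrow> real^'m \<Rightarrow> real \<Rightarrow> real" where
  "gfun P M i x lam \<rho> =
     own_cost P i (fst x) + coupling P i (fst x) + lam \<bullet> constr P i (fst x)
       + \<rho> / 2 * (norm (constr P i (fst x)))\<^sup>2 + M i * (norm (snd x))\<^sup>2"

definition aug_lagrangian :: "('a::finite, 'c::finite, 'm::finite) problem \<Rightarrow> ('a \<Rightarrow> real) \<Rightarrow>
    real \<Rightarrow> ('a, 'c) primal \<Rightarrow> real^'c \<Rightarrow> real^'m^'a \<Rightarrow> real^'c^'a \<Rightarrow> real" where
  "aug_lagrangian P M \<rho> X Z lam mu = (\<Sum>i\<in>UNIV.
     gfun P M i (X $ i) (lam $ i) \<rho>
       + mu $ i \<bullet> (Aop (X $ i) - Emat P i *v Z)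
       + \<rho> / 2 * (norm (Aop (X $ i) - Emat P i *v Z))\<^sup>2)"

definition subfeasible ::
    "('a::finite, 'c::finite, 'm::finite) problem \<Rightarrow> real \<Rightarrow> ('a, 'c) primal set" where
  "subfeasible P \<eta> = {X \<in> primal_space P. (\<Sum>i\<in>UNIV. norm (constr P i (fst (X $ i)))) \<le> \<eta>}"

definition subfeasible_proj :: "('a::finite, 'c::finite, 'm::finite) problem \<Rightarrow> real \<Rightarrow> 'a \<Rightarrow>
    ((real^'c) \<times> (real^'c)) set" where
  "subfeasible_proj P \<eta> i = (\<lambda>X. X $ i) ` subfeasible P \<eta>"

(* Differentiability is on the whole space, because the iterates (unlike Z) are not confined to
   the sets over which the Lipschitz bounds hold.  The norm on Jacobians is the Frobenius norm. *)

definition constr_regular :: "('a::finite, 'c::finite, 'm::finite) problem \<Rightarrow>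
    ('a \<Rightarrow> real) \<Rightarrow> ('a \<Rightarrow> real) \<Rightarrow> bool" where
  "constr_regular P Lh Mh \<longleftrightarrow> (\<forall>i.
     constr P i differentiable_on nbhd_space P i \<and>
     continuous_on (nbhd_space P i) (jacobian_on (nbhd_space P i) (constr P i)) \<and>
     (Lh i)-lipschitz_on (nbhd_set P i) (constr P i) \<and>
     (Mh i)-lipschitz_on (nbhd_set P i) (jacobian_on (nbhd_space P i) (constr P i)))"

definition cost_regular :: "('a::finite, 'c::finite, 'm::finite) problem \<Rightarrow>
    ('a \<Rightarrow> real) \<Rightarrow> ('a \<Rightarrow> real) \<Rightarrow> bool" where
  "cost_regular P Lf Mf \<longleftrightarrow> (\<forall>i.
     cost P i differentiable_on own_space P i \<and>
     (Lf i)-lipschitz_on (local_set P i) (cost P i) \<and>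
     (Mf i)-lipschitz_on (local_set P i) (grad_on (own_space P i) (cost P i)))"

definition coupling_regular :: "('a::finite, 'c::finite, 'm::finite) problem \<Rightarrow>
    ('a \<Rightarrow> real) \<Rightarrow> ('a \<Rightarrow> real) \<Rightarrow> bool" where
  "coupling_regular P Lphi Mphi \<longleftrightarrow> (\<forall>i.
     coupling P i differentiable_on nbhd_space P i \<and>
     (Lphi i)-lipschitz_on (nbhd_set P i) (coupling P i) \<and>
     (Mphi i)-lipschitz_on (nbhd_set P i) (grad_on (nbhd_space P i) (coupling P i)))"

(* The linear map of the block matrix ((J, O), (I, I)) with J the Jacobian of h_i at X_i;
   its adjoint is the map of the transposed matrix. *)

definition Fop :: "('a::finite, 'c::finite, 'm::finite) problem \<Rightarrow> 'a \<Rightarrow>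
    (real^'c) \<times> (real^'c) \<Rightarrow> (real^'c) \<times> (real^'c) \<Rightarrow> (real^'m) \<times> (real^'c)" where
  "Fop P i x w = (jacobian_on (nbhd_space P i) (constr P i) (fst x) *v fst w, fst w + snd w)"

definition F_qualified ::
    "('a::finite, 'c::finite, 'm::finite) problem \<Rightarrow> real \<Rightarrow> real \<Rightarrow> bool" where
  "F_qualified P \<eta> \<theta> \<longleftrightarrow> 0 < \<theta> \<and>
     (\<forall>i. \<forall>x\<in>subfeasible_proj P \<eta> i. \<forall>v\<in>constr_space P i \<times> nbhd_space P i.
        norm (adjoint (Fop P i x) v) \<ge> \<theta> * norm v)"

definition lagrangian_bounded_below ::
    "('a::finite, 'c::finite, 'm::finite) problem \<Rightarrow> ('a \<Rightarrow> real) \<Rightarrow> bool" where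
  "lagrangian_bounded_below P M \<longleftrightarrow> (\<forall>lam\<in>lam_space P. \<forall>mu\<in>mu_space P. \<exists>\<rho>>0.
     bdd_below {aug_lagrangian P M \<rho> X Z lam mu | X Z. X \<in> primal_space P \<and> Z \<in> global_set P})"

definition PLDM :: "('a::finite, 'c::finite, 'm::finite) problem \<Rightarrow> ('a \<Rightarrow> real) \<Rightarrow> real \<Rightarrow> real \<Rightarrow>
    (nat \<Rightarrow> 'a \<Rightarrow> real) \<Rightarrow> (nat \<Rightarrow> real) \<Rightarrow> (nat \<Rightarrow> ('a, 'c) primal) \<Rightarrow> (nat \<Rightarrow> real^'c) \<Rightarrow>
    (nat \<Rightarrow> real^'m^'a) \<Rightarrow> (nat \<Rightarrow> real^'c^'a) \<Rightarrow> bool" where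
  "PLDM P M \<eta> \<delta> c \<rho> X Z lam mu \<longleftrightarrow>
     0 < \<delta> \<and> 0 < \<rho> 0 \<and> (\<forall>k i. 0 < c k i) \<and>
     X 0 \<in> primal_space P \<and> lam 0 \<in> lam_space P \<and> mu 0 \<in> mu_space P \<and>
     (\<forall>k.
       is_arg_min (\<lambda>z. aug_lagrangian P M (\<rho> k) (X k) z (lam k) (mu k))
         (\<lambda>z. z \<in> global_set P) (Z (Suc k)) \<and>
       (\<forall>i. is_arg_min
         (\<lambda>x. mu k $ i \<bullet> (Aop x - Emat P i *v Z (Suc k))
            + \<rho> k / 2 * (norm (Aop x - Emat P i *v Z (Suc k)))\<^sup>2
            + grad_on (nbhd_space P i \<times> nbhd_space P i)
                (\<lambda>y. gfun P M i y (lam k $ i) (\<rho> k)) (X k $ i) \<bullet> (x - X k $ i)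
            + c k i / 2 * (norm (x - X k $ i))\<^sup>2)
         (\<lambda>x. x \<in> nbhd_space P i \<times> nbhd_space P i) (X (Suc k) $ i)) \<and>
       (\<forall>i. lam (Suc k) $ i = lam k $ i + \<rho> k *\<^sub>R constr P i (fst (X (Suc k) $ i))) \<and>
       (\<forall>i. mu (Suc k) $ i = mu k $ i + \<rho> k *\<^sub>R (Aop (X (Suc k) $ i) - Emat P i *v Z (Suc k))) \<and>
       \<rho> (Suc k) = (if X (Suc k) \<in> subfeasible P \<eta> then \<rho> k else \<rho> k + \<delta>))"

definition critical_R :: "('a::finite, 'c::finite, 'm::finite) problem \<Rightarrow> ('a \<Rightarrow> real) \<Rightarrow> real \<Rightarrow>
    ('a, 'c) primal \<Rightarrow> real^'c \<Rightarrow> real^'m^'a \<Rightarrow> real^'c^'a \<Rightarrow> bool" where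
  "critical_R P M \<rho> X Z lam mu \<longleftrightarrow>
     X \<in> primal_space P \<and> lam \<in> lam_space P \<and> mu \<in> mu_space P \<and>
     grad_on (primal_space P) (\<lambda>X'. aug_lagrangian P M \<rho> X' Z lam mu) X = 0 \<and>
     0 \<in> {grad_on UNIV (\<lambda>Z'. aug_lagrangian P M \<rho> X Z' lam mu) Z + g | g.
           g \<in> normal_cone (global_set P) Z} \<and>
     (\<forall>i. constr P i (fst (X $ i)) = 0 \<and> Aop (X $ i) = Emat P i *v Z)"

(* The normal cone must be required to be nonempty, i.e. Z feasible: the distance to the empty
   set is infinite, whereas infdist x {} = 0. *)

definition eps_critical_P :: "('a::finite, 'c::finite, 'm::finite) problem \<Rightarrow> real \<Rightarrow>
    ('a, 'c) primal \<Rightarrow> real^'c \<Rightarrow> bool" where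
  "eps_critical_P P \<epsilon> X Z \<longleftrightarrow> X \<in> primal_space P \<and>
     (\<exists>lam\<in>lam_space P. \<exists>mu\<in>mu_space P. \<exists>nu\<in>mu_space P.
       (\<forall>i.
         norm (grad_on (nbhd_space P i) (own_cost P i) (fst (X $ i))
             + grad_on (nbhd_space P i) (coupling P i) (fst (X $ i))
             + transpose (jacobian_on (nbhd_space P i) (constr P i) (fst (X $ i))) *v (lam $ i)
             + mu $ i) \<le> \<epsilon> \<and>
         norm (mu $ i + nu $ i) \<le> \<epsilon> \<and>
         norm (constr P i (fst (X $ i))) \<le> \<epsilon> \<and>
         norm (Aop (X $ i) - Emat P i *v Z) \<le> \<epsilon> \<and>
         norm (snd (X $ i)) \<le> \<epsilon>) \<and>
       normal_cone (global_set P) Z \<noteq> {} \<and>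
       infdist 0 {- (\<Sum>i\<in>UNIV. transpose (Emat P i) *v (mu $ i)) + g | g.
           g \<in> normal_cone (global_set P) Z} \<le> \<epsilon>)"

end

theory Submission
  imports Defs
begin

text \<open>
The only condition of an \<open>\<epsilon>\<close>-critical point of the original problem that a critical point of the
relaxation can violate is the bound on the slack \<open>Y\<^sub>i\<close>.  Indeed, at a point with \<open>h\<^sub>i(X\<^sub>i) = 0\<close>
and \<open>A\<^sub>i(X\<^sub>i, Y\<^sub>i) = E\<^sub>i Z\<close> the two penalty terms weighted by \<open>\<rho> / 2\<close> have zero gradient,
so whatever the value of \<open>\<rho>\<close> the Lagrangian has the partial gradients
\<open>\<nabla>f\<^sub>i + \<nabla>\<phi>\<^sub>i + (\<nabla>h\<^sub>i)\<^sup>T \<lambda>\<^sub>i + \<mu>\<^sub>i\<close> in \<open>X\<^sub>i\<close>, \<open>\<mu>\<^sub>i + 2 M\<^sub>i Y\<^sub>i\<close> in \<open>Y\<^sub>i\<close> and \<open>- \<Sum>\<^sub>i E\<^sub>i\<^sup>T \<mu>\<^sub>i\<close> in \<open>Z\<close>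
(lemmas \<open>has_grad_on_aug_lagrangian\<close> and \<open>has_grad_on_aug_lagrangian_consensus\<close>).
The first and the third are exactly the stationarity expressions of the original problem, and
choosing \<open>\<nu>\<^sub>i = - \<mu>\<^sub>i\<close> as the multiplier of the constraint \<open>Y\<^sub>i = 0\<close> makes the remaining one vanish.

The second gradient being zero gives \<open>Y\<^sub>i = - \<mu>\<^sub>i / (2 M\<^sub>i)\<close>.  A limit of the iterates inherits
the uniform bound on the multipliers \<open>\<mu>\<^sub>i\<close>, and this bound does not depend on \<open>M\<^sub>i\<close>; hence
taking \<open>M\<^sub>i\<close> at least that bound divided by \<open>2 \<epsilon>\<close> forces the norm of \<open>Y\<^sub>i\<close> below \<open>\<epsilon>\<close>.

Gradients are defined by a description operator, so that the equation \<open>\<nabla>L = 0\<close> says something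
only once the Lagrangian is known to be differentiable.  For this reason each gradient is obtained
as an instance of the relation \<open>has_grad_on\<close>, whose uniqueness (\<open>has_grad_on_unique\<close>) then
identifies it with the described one.
\<close>

section \<open>Gradients on a linear subspace\<close>

text \<open>A vector of the subspace that annihilates the subspace is zero; the derivative at a point of
the subspace is determined on the directions of the subspace because the point can be approached
along each of them.\<close>

lemma has_grad_on_unique:
  assumes S: "subspace S" and x: "x \<in> S"
    and g: "has_grad_on S f x g" and g': "has_grad_on S f x g'"
  shows "g = g'"
proof -
  have "g \<in> S" "g' \<in> S"
    and D: "(f has_derivative (\<lambda>d. g \<bullet> d)) (at x within S)"
    and D': "(f has_derivative (\<lambda>d. g' \<bullet> d)) (at x within S)"
    using g g' by (auto simp: has_grad_on_def)
  define u where "u = g - g'"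
  have u: "u \<in> S"
    using S \<open>g \<in> S\<close> \<open>g' \<in> S\<close> by (simp add: u_def subspace_diff)
  \<comment> \<open>Along the line through \<open>x\<close> in direction \<open>u\<close> the two derivatives must agree.\<close>
  define l where "l t = x + t *\<^sub>R u" for t :: real
  have l: "(l has_derivative (\<lambda>t. t *\<^sub>R u)) (at 0 within UNIV)"
    unfolding l_def by (auto intro!: derivative_eq_intros)
  have im: "l ` UNIV \<subseteq> S"
    using S x u by (auto simp: l_def subspace_add subspace_scale)
  have comp: "((\<lambda>t. f (l t)) has_derivative (\<lambda>t. a \<bullet> (t *\<^sub>R u))) (at 0)"
    if "(f has_derivative (\<lambda>d. a \<bullet> d)) (at x within S)" for a
  proof -
    have "(f has_derivative (\<lambda>d. a \<bullet> d)) (at (l 0) within l ` UNIV)"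
      using has_derivative_subset[OF that im] by (simp add: l_def)
    from has_derivative_in_compose[OF l this] show ?thesis by simp
  qed
  have "(\<lambda>t. g \<bullet> (t *\<^sub>R u)) = (\<lambda>t. g' \<bullet> (t *\<^sub>R u))"
    using has_derivative_unique[OF comp[OF D] comp[OF D']] .
  from fun_cong[OF this, of 1] have "u \<bullet> u = 0"
    by (simp add: u_def inner_diff_left)
  then show ?thesis by (simp add: u_def)
qed

lemma grad_on_eqI:
  assumes "subspace S" "x \<in> S" "has_grad_on S f x g"
  shows "grad_on S f x = g"
  unfolding grad_on_def using assms has_grad_on_unique by blast

text \<open>The derivative is some functional \<open>d \<mapsto> v \<bullet> d\<close>, but \<open>v\<close> need not lie in the subspace; its
orthogonal projection onto the subspace represents the same functional on the subspace.\<close>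

lemma has_grad_on_grad_on:
  assumes S: "subspace S" and x: "x \<in> S" and f: "f differentiable (at x within S)"
  shows "has_grad_on S f x (grad_on S f x)"
proof -
  obtain D where D: "(f has_derivative D) (at x within S)"
    using f by (auto simp: differentiable_def)
  interpret D: bounded_linear D using D by (rule has_derivative_bounded_linear)
  define v where "v = adjoint D 1"
  have Dv: "D d = v \<bullet> d" for d
    using adjoint_works[OF D.linear, of d 1] by (simp add: v_def inner_commute)
  obtain g w where g: "g \<in> span S" and w: "\<And>s. s \<in> span S \<Longrightarrow> orthogonal w s" and v: "v = g + w"
    using orthogonal_subspace_decomp_exists[of S v] by metis
  have gS: "g \<in> S" using g S by (simp add: span_eq_iff[THEN iffD2])
  have eq: "g \<bullet> d = D d" if "d \<in> S" for d
    using w[OF span_base[OF that]] by (simp add: Dv v inner_add_left orthogonal_def)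
  have "(f has_derivative (\<lambda>d. g \<bullet> d)) (at x within S)"
    unfolding has_derivative_within
  proof
    have "((\<lambda>y. (1 / norm (y - x)) *\<^sub>R (f y - (f x + D (y - x)))) \<longlongrightarrow> 0) (at x within S)"
      using D by (simp add: has_derivative_within)
    moreover have "\<forall>\<^sub>F y in at x within S.
        (1 / norm (y - x)) *\<^sub>R (f y - (f x + D (y - x))) =
        (1 / norm (y - x)) *\<^sub>R (f y - (f x + g \<bullet> (y - x)))"
      using S x by (auto simp: eventually_at_filter eq subspace_diff)
    ultimately show "((\<lambda>y. (1 / norm (y - x)) *\<^sub>R (f y - (f x + g \<bullet> (y - x)))) \<longlongrightarrow> 0)
        (at x within S)"
      by (rule Lim_transform_eventually)
  qed (rule bounded_linear_inner_right)
  then have "has_grad_on S f x g" using gS by (simp add: has_grad_on_def)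
  then show ?thesis using grad_on_eqI[OF S x] by simp
qed

lemma has_grad_on_add:
  assumes "subspace S" "has_grad_on S f x a" "has_grad_on S g x b"
  shows "has_grad_on S (\<lambda>y. f y + g y) x (a + b)"
  using assms has_derivative_add[of f _ "at x within S" g]
  by (auto simp: has_grad_on_def subspace_add inner_add_left)

text \<open>The scalar product with a vector-valued function is the combination of its components with
constant coefficients, and the transposed Jacobian combines the gradients in the same way.\<close>

lemma has_grad_on_inner_jacobian:
  fixes h :: "real^'c::finite \<Rightarrow> real^'m::finite"
  assumes S: "subspace S" and x: "x \<in> S" and h: "h differentiable (at x within S)"
  shows "has_grad_on S (\<lambda>y. v \<bullet> h y) x (transpose (jacobian_on S h x) *v v)"
proof -
  let ?g = "\<lambda>r. grad_on S (\<lambda>y. h y $ r) x"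
  have g: "has_grad_on S (\<lambda>y. h y $ r) x (?g r)" for r
  proof (rule has_grad_on_grad_on[OF S x])
    show "(\<lambda>y. h y $ r) differentiable (at x within S)"
      using h bounded_linear.has_derivative[OF bounded_linear_vec_nth]
      unfolding differentiable_def by blast
  qed
  have eq: "transpose (jacobian_on S h x) *v v = (\<Sum>r\<in>UNIV. (v $ r) *\<^sub>R ?g r)"
    by (simp add: vec_eq_iff matrix_vector_mult_def transpose_def jacobian_on_def mult.commute)
  have "((\<lambda>y. \<Sum>r\<in>UNIV. v $ r * h y $ r) has_derivative
      (\<lambda>d. \<Sum>r\<in>UNIV. v $ r * (?g r \<bullet> d))) (at x within S)"
    using g by (auto simp: has_grad_on_def intro!: has_derivative_sum has_derivative_mult_right)
  moreover have "(\<lambda>d. \<Sum>r\<in>UNIV. v $ r * (?g r \<bullet> d)) =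
      (\<lambda>d. (\<Sum>r\<in>UNIV. (v $ r) *\<^sub>R ?g r) \<bullet> d)"
    by (simp add: fun_eq_iff inner_sum_left)
  moreover have "(\<Sum>r\<in>UNIV. (v $ r) *\<^sub>R ?g r) \<in> S"
    using g S by (auto simp: has_grad_on_def intro!: subspace_sum subspace_scale)
  ultimately show ?thesis
    unfolding has_grad_on_def eq by (simp add: inner_vec_def[of v])
qed

lemma has_grad_on_norm_squared_at_zero:
  fixes h :: "'v::euclidean_space \<Rightarrow> 'w::euclidean_space"
  assumes "subspace S" "h differentiable (at x within S)" "h x = 0"
  shows "has_grad_on S (\<lambda>y. a * (norm (h y))\<^sup>2) x 0"
proof -
  obtain D where D: "(h has_derivative D) (at x within S)"
    using assms(2) by (auto simp: differentiable_def)
  have "((\<lambda>y. a * (h y \<bullet> h y)) has_derivative (\<lambda>d. 0)) (at x within S)"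
    using has_derivative_mult_right[OF has_derivative_inner[OF D D], of a] assms(3) by simp
  then show ?thesis
    using assms(1) by (simp add: has_grad_on_def power2_norm_eq_inner subspace_0)
qed

lemma has_grad_on_norm_squared:
  assumes "subspace S" "y \<in> S"
  shows "has_grad_on S (\<lambda>z. a * (norm z)\<^sup>2) y ((2 * a) *\<^sub>R y)"
proof -
  have "((\<lambda>z. a * (z \<bullet> z)) has_derivative (\<lambda>d. (2 * a) *\<^sub>R y \<bullet> d)) (at y within S)"
    by (auto intro!: derivative_eq_intros simp: inner_commute)
  then show ?thesis
    using assms by (simp add: has_grad_on_def power2_norm_eq_inner subspace_scale)
qed

lemma has_grad_on_fst_snd:
  assumes f: "has_grad_on S f (fst x) a" and g: "has_grad_on T g (snd x) b"
  shows "has_grad_on (S \<times> T) (\<lambda>z. f (fst z) + g (snd z)) x (a, b)"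
proof -
  have "((\<lambda>z. f (fst z)) has_derivative (\<lambda>d. a \<bullet> fst d)) (at x within S \<times> T)"
    by (rule has_derivative_in_compose[of fst fst x "S \<times> T" f "\<lambda>d. a \<bullet> d"])
      (use f in \<open>auto simp: has_grad_on_def intro!: derivative_eq_intros
         intro: has_derivative_subset\<close>)
  moreover have "((\<lambda>z. g (snd z)) has_derivative (\<lambda>d. b \<bullet> snd d)) (at x within S \<times> T)"
    by (rule has_derivative_in_compose[of snd snd x "S \<times> T" g "\<lambda>d. b \<bullet> d"])
      (use g in \<open>auto simp: has_grad_on_def intro!: derivative_eq_intros
         intro: has_derivative_subset\<close>)
  ultimately have "((\<lambda>z. f (fst z) + g (snd z)) has_derivative (\<lambda>d. a \<bullet> fst d + b \<bullet> snd d))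
      (at x within S \<times> T)"
    by (rule has_derivative_add)
  then show ?thesis
    using f g by (simp add: has_grad_on_def inner_prod_def)
qed

lemma has_grad_on_block_sum:
  fixes X :: "'v::euclidean_space^'a::finite"
  assumes "\<And>i. has_grad_on (S i) (T i) (X $ i) (G $ i)"
  shows "has_grad_on {X. \<forall>i. X $ i \<in> S i} (\<lambda>X. \<Sum>i\<in>UNIV. T i (X $ i)) X G"
proof -
  let ?S = "{X. \<forall>i. X $ i \<in> S i}"
  have "((\<lambda>X. T i (X $ i)) has_derivative (\<lambda>d. G $ i \<bullet> d $ i)) (at X within ?S)" for i
  proof (rule has_derivative_in_compose[of "\<lambda>X. X $ i" "\<lambda>d. d $ i" X ?S "T i" "\<lambda>d. G $ i \<bullet> d"])
    show "((\<lambda>X. X $ i) has_derivative (\<lambda>d. d $ i)) (at X within ?S)"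
      by (rule bounded_linear_imp_has_derivative[OF bounded_linear_vec_nth])
    show "(T i has_derivative (\<lambda>d. G $ i \<bullet> d)) (at (X $ i) within (\<lambda>X. X $ i) ` ?S)"
      using assms[of i] by (auto simp: has_grad_on_def intro: has_derivative_subset)
  qed
  then have "((\<lambda>X. \<Sum>i\<in>UNIV. T i (X $ i)) has_derivative (\<lambda>d. \<Sum>i\<in>UNIV. G $ i \<bullet> d $ i))
      (at X within ?S)"
    by (rule has_derivative_sum)
  then show ?thesis
    using assms by (auto simp: has_grad_on_def inner_vec_def)
qed

section \<open>Gradients of the augmented Lagrangian at feasible points\<close>

lemma subspace_coord_space: "subspace (coord_space I)"
  by (auto simp: subspace_def coord_space_def)

lemma subspace_primal_space: "subspace (primal_space P)"
  using subspace_coord_space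
  by (auto simp: subspace_def primal_space_def mem_Times_iff)

lemma bounded_linear_restr: "bounded_linear (restr I)"
  unfolding linear_conv_bounded_linear[symmetric]
  by (rule linearI) (auto simp: restr_def vec_eq_iff)

lemma own_cost_differentiable:
  assumes "cost P i differentiable_on own_space P i"
  shows "own_cost P i differentiable (at x within S)"
proof -
  have "restr (own_coords P i) x \<in> own_space P i"
    by (simp add: restr_def coord_space_def)
  then obtain D where D: "(cost P i has_derivative D)
      (at (restr (own_coords P i) x) within own_space P i)"
    using assms by (auto simp: differentiable_on_def differentiable_def)
  have "restr (own_coords P i) ` S \<subseteq> own_space P i"
    by (auto simp: restr_def coord_space_def)
  from has_derivative_in_compose[OF bounded_linear_imp_has_derivative[OF bounded_linear_restr]
      has_derivative_subset[OF D this]]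
  show ?thesis
    unfolding differentiable_def own_cost_def[abs_def] by blast
qed

text \<open>Where the affine constraint \<open>fst x + snd x = e\<close> holds, the quadratic penalty contributes
nothing; the linear term contributes \<open>\<mu>\<close> to both components, since both enter the sum.\<close>

lemma has_grad_on_affine_coupling:
  assumes "x \<in> S \<times> S" "\<mu> \<in> S" "Aop x = e"
  shows "has_grad_on (S \<times> S) (\<lambda>y. \<mu> \<bullet> (Aop y - e) + a * (norm (Aop y - e))\<^sup>2) x (\<mu>, \<mu>)"
proof -
  have "((\<lambda>y. \<mu> \<bullet> (fst y + snd y - e) + a * ((fst y + snd y - e) \<bullet> (fst y + snd y - e)))
      has_derivative (\<lambda>d. \<mu> \<bullet> (fst d + snd d))) (at x within S \<times> S)"
    using assms(3) by (auto intro!: derivative_eq_intros simp: Aop_def)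
  then show ?thesis
    using assms
    by (simp add: has_grad_on_def power2_norm_eq_inner Aop_def inner_add_right inner_prod_def)
qed

text \<open>With \<open>Z\<close> and the multipliers held constant, the variables of each agent occur in one summand
only, so the gradient splits into one block per agent.\<close>

lemma has_grad_on_aug_lagrangian:
  assumes cost: "\<And>i. cost P i differentiable_on own_space P i"
    and coupling: "\<And>i. coupling P i differentiable_on nbhd_space P i"
    and constr: "\<And>i. constr P i differentiable_on nbhd_space P i"
    and X: "X \<in> primal_space P" and mu: "mu \<in> mu_space P"
    and h: "\<And>i. constr P i (fst (X $ i)) = 0" and A: "\<And>i. Aop (X $ i) = Emat P i *v Z"
  shows "has_grad_on (primal_space P) (\<lambda>X. aug_lagrangian P M \<rho> X Z lam mu) X
    (\<chi> i. (grad_on (nbhd_space P i) (own_cost P i) (fst (X $ i))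
             + grad_on (nbhd_space P i) (coupling P i) (fst (X $ i))
             + transpose (jacobian_on (nbhd_space P i) (constr P i) (fst (X $ i))) *v (lam $ i)
             + mu $ i,
           mu $ i + (2 * M i) *\<^sub>R snd (X $ i)))"
  (is "has_grad_on _ _ X ?G")
proof -
  have "has_grad_on (nbhd_space P i \<times> nbhd_space P i)
      (\<lambda>x. gfun P M i x (lam $ i) \<rho> + mu $ i \<bullet> (Aop x - Emat P i *v Z)
        + \<rho> / 2 * (norm (Aop x - Emat P i *v Z))\<^sup>2) (X $ i) (?G $ i)" for i
  proof -
    let ?S = "nbhd_space P i" and ?x = "fst (X $ i)" and ?y = "snd (X $ i)"
    have S: "subspace ?S" by (rule subspace_coord_space)
    have Xi: "X $ i \<in> ?S \<times> ?S" using X by (simp add: primal_space_def)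
    then have x: "?x \<in> ?S" and y: "?y \<in> ?S" by (auto simp: mem_Times_iff)
    have mui: "mu $ i \<in> ?S" using mu by (simp add: mu_space_def)
    have d: "coupling P i differentiable (at ?x within ?S)"
        "constr P i differentiable (at ?x within ?S)"
      using coupling constr x by (auto simp: differentiable_on_def)
    have 1: "has_grad_on ?S (\<lambda>x. own_cost P i x + coupling P i x + lam $ i \<bullet> constr P i x
          + \<rho> / 2 * (norm (constr P i x))\<^sup>2) ?x
        (grad_on ?S (own_cost P i) ?x + grad_on ?S (coupling P i) ?x
          + transpose (jacobian_on ?S (constr P i) ?x) *v (lam $ i) + 0)"
      by (intro has_grad_on_add has_grad_on_grad_on has_grad_on_inner_jacobian
          has_grad_on_norm_squared_at_zero own_cost_differentiable S x d h cost)
    have "has_grad_on (?S \<times> ?S)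
      (\<lambda>x. gfun P M i x (lam $ i) \<rho> + (mu $ i \<bullet> (Aop x - Emat P i *v Z)
        + \<rho> / 2 * (norm (Aop x - Emat P i *v Z))\<^sup>2)) (X $ i)
      ((grad_on ?S (own_cost P i) ?x + grad_on ?S (coupling P i) ?x
          + transpose (jacobian_on ?S (constr P i) ?x) *v (lam $ i) + 0, (2 * M i) *\<^sub>R ?y)
        + (mu $ i, mu $ i))"
      unfolding gfun_def
      by (intro has_grad_on_add has_grad_on_fst_snd[OF 1] has_grad_on_norm_squared
          has_grad_on_affine_coupling subspace_Times S y Xi mui A)
    then show ?thesis by (simp add: add.assoc[symmetric] add.commute[of "mu $ i" "(2 * M i) *\<^sub>R ?y"])
  qed
  from has_grad_on_block_sum[OF this] show ?thesis
    unfolding aug_lagrangian_def primal_space_def by simp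
qed

lemma has_grad_on_aug_lagrangian_consensus:
  assumes A: "\<And>i. Aop (X $ i) = Emat P i *v Z"
  shows "has_grad_on UNIV (\<lambda>Z. aug_lagrangian P M \<rho> X Z lam mu) Z
    (- (\<Sum>i\<in>UNIV. transpose (Emat P i) *v (mu $ i)))"
proof -
  have "((\<lambda>Z. gfun P M i (X $ i) (lam $ i) \<rho> + mu $ i \<bullet> (Aop (X $ i) - Emat P i *v Z)
        + \<rho> / 2 * (norm (Aop (X $ i) - Emat P i *v Z))\<^sup>2)
      has_derivative (\<lambda>d. - (mu $ i \<bullet> (Emat P i *v d)))) (at Z)" for i
  proof -
    have E: "((\<lambda>Z. Emat P i *v Z) has_derivative (\<lambda>d. Emat P i *v d)) (at Z)"
      by (rule bounded_linear_imp_has_derivative)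
        (rule matrix_vector_mul_bounded_linear)
    show ?thesis
      unfolding power2_norm_eq_inner
      by (auto intro!: derivative_eq_intros E simp: A)
  qed
  then have "((\<lambda>Z. aug_lagrangian P M \<rho> X Z lam mu)
      has_derivative (\<lambda>d. \<Sum>i\<in>UNIV. - (mu $ i \<bullet> (Emat P i *v d)))) (at Z)"
    unfolding aug_lagrangian_def by (rule has_derivative_sum)
  moreover have "(\<lambda>d. \<Sum>i\<in>UNIV. - (mu $ i \<bullet> (Emat P i *v d))) =
      (\<lambda>d. - (\<Sum>i\<in>UNIV. transpose (Emat P i) *v (mu $ i)) \<bullet> d)"
    by (simp add: fun_eq_iff inner_sum_left sum_negf dot_lmul_matrix)
  ultimately show ?thesis
    by (simp add: has_grad_on_def)
qed

section \<open>Large slack penalties\<close>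

theorem theorem2:
  fixes P :: "('a::finite, 'c::finite, 'm::finite) problem"
    and Lh Mh Lf Mf Lphi Mphi Mlam Mmu :: "'a \<Rightarrow> real"
    and \<epsilon> \<eta> \<theta> :: real
  assumes "well_formed P"
    and "constr_regular P Lh Mh"
    and "cost_regular P Lf Mf"
    and "coupling_regular P Lphi Mphi"
    and "0 < \<eta>"
    and "\<And>i. bounded (fst ` subfeasible_proj P \<eta> i)"
    and "F_qualified P \<eta> \<theta>"
    and "0 < \<epsilon>"
  shows "\<exists>Mbar :: 'a \<Rightarrow> real. \<forall>M :: 'a \<Rightarrow> real. (\<forall>i. 0 < M i \<and> Mbar i \<le> M i) \<longrightarrow>
    lagrangian_bounded_below P M \<longrightarrow>
    (\<forall>\<delta> c \<rho> X Z lam mu.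
      PLDM P M \<eta> \<delta> c \<rho> X Z lam mu \<longrightarrow>
      (\<forall>k i. norm (lam k $ i) \<le> Mlam i \<and> norm (mu k $ i) \<le> Mmu i) \<longrightarrow>
      (\<forall>r \<rho>s Xs Zs lams mus.
        strict_mono (r :: nat \<Rightarrow> nat) \<longrightarrow>
        (\<lambda>k. (X (r k), Z (r k), lam (r k), mu (r k))) \<longlonglongrightarrow> (Xs, Zs, lams, mus) \<longrightarrow>
        0 < \<rho>s \<longrightarrow> critical_R P M \<rho>s Xs Zs lams mus \<longrightarrow>
        eps_critical_P P \<epsilon> Xs Zs))"
  \<comment> \<open>\<open>norm Y\<^sub>i = norm \<mu>\<^sub>i / (2 M\<^sub>i)\<close> is at most \<open>\<epsilon>\<close> from this threshold on.\<close>
proof (intro exI[of _ "\<lambda>i. Mmu i / (2 * \<epsilon>)"] allI impI)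
  fix M \<delta> c \<rho> X Z lam mu r \<rho>s Xs Zs lams mus
  assume M: "\<forall>i. 0 < M i \<and> Mmu i / (2 * \<epsilon>) \<le> M i"
    and bound: "\<forall>k i. norm (lam k $ i) \<le> Mlam i \<and> norm (mu k $ i) \<le> Mmu i"
    and lim: "(\<lambda>k. (X (r k), Z (r k), lam (r k), mu (r k))) \<longlonglongrightarrow> (Xs, Zs, lams, mus)"
    and crit: "critical_R P M \<rho>s Xs Zs lams mus"
  have Xs: "Xs \<in> primal_space P" and lams: "lams \<in> lam_space P" and mus: "mus \<in> mu_space P"
    and feas: "constr P i (fst (Xs $ i)) = 0" "Aop (Xs $ i) = Emat P i *v Zs"
    and gradX: "grad_on (primal_space P) (\<lambda>X'. aug_lagrangian P M \<rho>s X' Zs lams mus) Xs = 0"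
    and gradZ: "0 \<in> {grad_on UNIV (\<lambda>Z'. aug_lagrangian P M \<rho>s Xs Z' lams mus) Zs + g | g.
           g \<in> normal_cone (global_set P) Zs}" for i
    using crit by (auto simp: critical_R_def)
  have diff: "cost P i differentiable_on own_space P i"
      "coupling P i differentiable_on nbhd_space P i"
      "constr P i differentiable_on nbhd_space P i" for i
    using assms by (auto simp: cost_regular_def coupling_regular_def constr_regular_def)

  have "(\<lambda>k. mu (r k)) \<longlonglongrightarrow> mus"
    using tendsto_snd[OF tendsto_snd[OF tendsto_snd[OF lim]]] by simp
  then have mu_bound: "norm (mus $ i) \<le> Mmu i" for i
    using bound by (intro Lim_norm_ubound[OF _ tendsto_vec_nth]) auto

  let ?gX = "\<lambda>i. grad_on (nbhd_space P i) (own_cost P i) (fst (Xs $ i))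
             + grad_on (nbhd_space P i) (coupling P i) (fst (Xs $ i))
             + transpose (jacobian_on (nbhd_space P i) (constr P i) (fst (Xs $ i))) *v (lams $ i)
             + mus $ i"
  have "(\<chi> i. (?gX i, mus $ i + (2 * M i) *\<^sub>R snd (Xs $ i))) = 0"
    using grad_on_eqI[OF subspace_primal_space Xs
        has_grad_on_aug_lagrangian[OF diff Xs mus feas, of M \<rho>s lams]] gradX
    by simp
  then have statX: "?gX i = 0" and statY: "mus $ i + (2 * M i) *\<^sub>R snd (Xs $ i) = 0" for i
    by (auto simp: vec_eq_iff[of _ "0 :: _^'a"] zero_prod_def)

  have slack: "norm (snd (Xs $ i)) \<le> \<epsilon>" for i
  proof -
    have "2 * M i * norm (snd (Xs $ i)) = norm ((2 * M i) *\<^sub>R snd (Xs $ i))"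
      using M by (simp add: less_imp_le)
    also have "\<dots> = norm (mus $ i)"
      using statY[of i] by (metis add_eq_0_iff norm_minus_cancel)
    also have "\<dots> \<le> 2 * M i * \<epsilon>"
      using mu_bound[of i] M[rule_format, of i] \<open>0 < \<epsilon>\<close> by (simp add: field_simps)
    finally show ?thesis using M by simp
  qed

  \<comment> \<open>Some normal vector cancels the gradient in \<open>Z\<close> exactly, so the distance in question is zero
    and the normal cone is nonempty.\<close>
  let ?D = "{- (\<Sum>i\<in>UNIV. transpose (Emat P i) *v (mus $ i)) + g | g.
      g \<in> normal_cone (global_set P) Zs}"
  have statZ: "0 \<in> ?D"
    using gradZ grad_on_eqI[OF subspace_UNIV UNIV_I
        has_grad_on_aug_lagrangian_consensus[OF feas(2), of M \<rho>s lams mus]]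
    by simp
  then have "normal_cone (global_set P) Zs \<noteq> {}" by blast
  moreover have "infdist 0 ?D \<le> \<epsilon>"
    using infdist_zero[OF statZ] \<open>0 < \<epsilon>\<close> by simp
  moreover have "- mus \<in> mu_space P"
    using mus by (simp add: mu_space_def subspace_neg[OF subspace_coord_space])
  ultimately show "eps_critical_P P \<epsilon> Xs Zs"
    unfolding eps_critical_P_def
    using Xs lams mus statX slack feas \<open>0 < \<epsilon>\<close>
    by (intro conjI bexI[of _ lams] bexI[of _ mus] bexI[of _ "- mus"]) auto
qed

end
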